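(* Fix $p\in(0,1)$ and a graph $H$ with $h$ vertices and at least one edge. There is a constant $C=C(p,H)$ such that for every $n\ge1$, if $G\in\mathbb{G}(n,p)$ and $X_H$ denotes the number of copies of $H$ in $G$, then for every $x\in\mathbb{N}$, \[ \Pr\left(|X_H-x|\le n^{h-2}\right)\le \frac{C}{n}. \]
   Context: $\mathbb{G}(n,p)$ is the binomial random graph on vertex set $\{1,\dots,n\}$ in which each pair of vertices is an edge independently with probability $p$. A copy of $H$ in $G$ is a subgraph of $G$ isomorphic to $H$. *)

theory Defs
  imports "HOL-Probability.Probability" "HOL-Probability.Product_PMF"
begin

text \<open>A graph is given by its vertex set and its set of edges, an edge being a
  two-element set of vertices.\<close>

type_synonym 'a ugraph = "'a set \<times> 'a set set"

abbreviation verts :: "'a ugraph \<Rightarrow> 'a set" where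
  "verts G \<equiv> fst G"

abbreviation edges :: "'a ugraph \<Rightarrow> 'a set set" where
  "edges G \<equiv> snd G"

definition vertex_pairs :: "'a set \<Rightarrow> 'a set set" where
  "vertex_pairs V = {e. e \<subseteq> V \<and> card e = 2}"

definition finite_simple_graph :: "'a ugraph \<Rightarrow> bool" where
  "finite_simple_graph G \<longleftrightarrow> finite (verts G) \<and> edges G \<subseteq> vertex_pairs (verts G)"

definition subgraph :: "'a ugraph \<Rightarrow> 'a ugraph \<Rightarrow> bool" where
  "subgraph H G \<longleftrightarrow>
     finite_simple_graph H \<and> verts H \<subseteq> verts G \<and> edges H \<subseteq> edges G"

definition graph_iso :: "'a ugraph \<Rightarrow> 'b ugraph \<Rightarrow> bool" where
  "graph_iso G H \<longleftrightarrow>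
     (\<exists>f. bij_betw f (verts G) (verts H) \<and>
          (\<forall>u\<in>verts G. \<forall>v\<in>verts G. {u, v} \<in> edges G \<longleftrightarrow> {f u, f v} \<in> edges H))"

text \<open>Copies are not required to be induced and are unlabelled: a subgraph counts once,
  however many isomorphisms to \<open>H\<close> it has. As a subgraph carries its own vertex set,
  isolated vertices of \<open>H\<close> matter.\<close>

definition copies :: "'a ugraph \<Rightarrow> 'b ugraph \<Rightarrow> 'b ugraph set" where
  "copies H G = {K. subgraph K G \<and> graph_iso H K}"

definition num_copies :: "'a ugraph \<Rightarrow> 'b ugraph \<Rightarrow> nat" where
  "num_copies H G = card (copies H G)"

text \<open>The coin \<open>c e\<close> decides whether \<open>e\<close> is an edge. The argument \<open>False\<close> is only the
  default value of \<open>c\<close> outside the pairs of vertices.\<close>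

definition binomial_random_graph :: "nat \<Rightarrow> real \<Rightarrow> nat ugraph pmf" where
  "binomial_random_graph n p =
     map_pmf (\<lambda>c. ({1..n}, {e \<in> vertex_pairs {1..n}. c e}))
       (Pi_pmf (vertex_pairs {1..n}) False (\<lambda>_. bernoulli_pmf p))"

end

theory Submission
  imports Defs "HOL-Probability.Hoeffding" "HOL-Real_Asymp.Real_Asymp"
begin

text \<open>Adding an edge to a graph in which every \<open>h - 1\<close> vertices have linearly many common neighbours
  creates at least \<open>\<delta> = \<Omega>(n ^ (h - 2))\<close> new copies of \<open>H\<close>, already because the new edge lies in that
  many \<open>h\<close>-cliques. Hence the edge sets of this kind whose number of copies falls into a fixed
  window of length \<open>\<delta>\<close> form an antichain. By the LYM inequality an antichain has probability at
  most the largest weight of the binomial distribution with \<open>n choose 2\<close> trials, which is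
  \<open>O(1 / n)\<close>, and boundedly many windows cover the interval around \<open>x\<close>. By Hoeffding's
  inequality the remaining graphs have exponentially small probability.\<close>

section \<open>Antichains of random sets\<close>

text \<open>With \<open>b\<close> and \<open>B\<close> the weights of the binomial distributions with \<open>n\<close> and \<open>n + 1\<close> trials,
  \<open>b i - b (i - 1) = B i * ((n + 1) p - i) / ((n + 1) p (1 - p))\<close>. Telescoping therefore bounds
  every \<open>b k\<close> by the mean absolute deviation of \<open>B\<close>, which is at most its standard deviation.\<close>

lemma Bernstein_le_inverse_sqrt:
  fixes p :: real
  assumes p: "0 < p" "p < 1"
  shows "Bernstein n k p \<le> 1 / sqrt ((real n + 1) * p * (1 - p))"
proof (cases "k \<le> n")
  case True
  define s where "s = sqrt ((real n + 1) * p * (1 - p))"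
  have s: "s > 0" and s2: "s\<^sup>2 = (real n + 1) * p * (1 - p)"
    using p by (auto simp: s_def)
  define B where "B = (\<lambda>i. Bernstein (Suc n) i p)"
  \<comment> \<open>shifted by one: \<open>b 0\<close> stands for the weight at \<open>-1\<close>\<close>
  define b where "b = (\<lambda>i. if i = 0 then 0 else Bernstein n (i - 1) p)"
  have Bnn: "B i \<ge> 0" for i
    using p by (auto simp: B_def Bernstein_def)
  \<comment> \<open>\<open>up\<close> and \<open>down\<close> come from the two absorption
    identities for binomial coefficients and link the weights for \<open>n + 1\<close> trials to
    those for \<open>n\<close>.\<close>
  have up: "(real n + 1 - real i) * B i = (real n + 1) * (1 - p) * b (Suc i)" if "i \<le> n" for i
  proof -
    have "real ((Suc n - i) * (Suc n choose i)) = real (Suc n * (n choose i))"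
      using binomial_absorb_comp[of "Suc n" i] by simp
    then have "real (Suc n - i) * real (Suc n choose i) = real (Suc n) * real (n choose i)"
      by (simp only: of_nat_mult)
    moreover have "real (Suc n - i) = real n + 1 - real i"
      using that by linarith
    ultimately have "(real n + 1 - real i) * real (Suc n choose i) = (real n + 1) * real (n choose i)"
      by (simp add: algebra_simps)
    moreover have "(real n + 1 - real i) * B i
        = ((real n + 1 - real i) * real (Suc n choose i)) * (p ^ i * (1 - p) ^ (Suc n - i))"
      by (simp only: B_def Bernstein_def mult_ac)
    ultimately show ?thesis
      using that by (simp add: b_def Bernstein_def Suc_diff_le mult_ac)
  qed
  have down: "real i * B i = (real n + 1) * p * b i" for i
  proof (cases i)
    case (Suc j)
    have "real (Suc j * (Suc n choose Suc j)) = real (Suc n * (n choose j))"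
      by (simp only: Suc_times_binomial)
    then have "real i * real (Suc n choose i) = real (Suc n) * real (n choose j)"
      unfolding Suc by (simp only: of_nat_mult)
    moreover have "real i * B i = (real i * real (Suc n choose i)) * (p ^ i * (1 - p) ^ (Suc n - i))"
      by (simp only: B_def Bernstein_def mult_ac)
    ultimately show ?thesis
      using Suc by (simp add: b_def Bernstein_def mult_ac)
  qed (simp add: b_def)
  have step: "b (Suc i) - b i = B i * ((real n + 1) * p - real i) / s\<^sup>2" if "i \<le> n" for i
  proof -
    \<comment> \<open>Weighting \<open>up\<close> by \<open>p\<close> and \<open>down\<close> by
      \<open>1 - p\<close> makes the terms in \<open>p * i\<close> cancel.\<close>
    have "s\<^sup>2 * (b (Suc i) - b i) = p * ((real n + 1) * (1 - p) * b (Suc i))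
        - (1 - p) * ((real n + 1) * p * b i)"
      by (simp add: s2 algebra_simps)
    also have "\<dots> = B i * ((real n + 1) * p - real i)"
      unfolding up[OF that, symmetric] down[symmetric] by (simp add: algebra_simps)
    finally show ?thesis
      using s by (simp add: field_simps)
  qed
  \<comment> \<open>The variance of \<open>B\<close>, computed from its first two factorial
    moments.\<close>
  have var: "(\<Sum>i\<le>Suc n. B i * (real i - (real n + 1) * p)\<^sup>2) = s\<^sup>2"
  proof -
    let ?m = "(real n + 1) * p"
    have "(\<Sum>i\<le>Suc n. B i * (real i - ?m)\<^sup>2) =
      (\<Sum>i\<le>Suc n. real i * (real i - 1) * B i) + (1 - 2 * ?m) * (\<Sum>i\<le>Suc n. real i * B i)
        + ?m\<^sup>2 * (\<Sum>i\<le>Suc n. B i)"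
      unfolding sum_distrib_left sum.distrib[symmetric]
      by (intro sum.cong refl) (simp add: power2_eq_square algebra_simps)
    also have "(\<Sum>i\<le>Suc n. real i * (real i - 1) * B i) = (real n + 1) * real n * p\<^sup>2"
      using sum_kk_Bernstein[of "Suc n" p] by (simp only: B_def) simp
    also have "(\<Sum>i\<le>Suc n. real i * B i) = (real n + 1) * p"
      using sum_k_Bernstein[of "Suc n" p] by (simp only: B_def) simp
    also have "(\<Sum>i\<le>Suc n. B i) = 1"
      using sum_Bernstein[of "Suc n" p] by (simp only: B_def)
    also have "(real n + 1) * real n * p\<^sup>2 + (1 - 2 * ?m) * ((real n + 1) * p) + ?m\<^sup>2 * 1 = s\<^sup>2"
      unfolding s2 by (simp add: power2_eq_square algebra_simps)
    finally show ?thesis .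
  qed
  \<comment> \<open>This takes the place of Cauchy-Schwarz: since \<open>s\<close> is the standard
    deviation of \<open>B\<close>, the right-hand side averages to \<open>s\<close> when
    \<open>y\<close> is the deviation from the mean.\<close>
  have amgm: "\<bar>y\<bar> \<le> (y\<^sup>2 / s + s) / 2" for y :: real
  proof -
    have "0 \<le> (\<bar>y\<bar> - s)\<^sup>2" by simp
    then have "2 * s * \<bar>y\<bar> \<le> y\<^sup>2 + s\<^sup>2"
      by (simp add: power2_diff algebra_simps)
    then show ?thesis
      using s by (simp add: field_simps power2_eq_square)
  qed
  have "Bernstein n k p = b (Suc k) - b 0"
    by (simp add: b_def)
  also have "\<dots> = (\<Sum>i<Suc k. b (Suc i) - b i)"
    by (rule sum_lessThan_telescope[symmetric])
  also have "\<dots> \<le> (\<Sum>i<Suc k. B i * \<bar>real i - (real n + 1) * p\<bar> / s\<^sup>2)"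
  proof (intro sum_mono)
    fix i assume "i \<in> {..<Suc k}"
    then have "b (Suc i) - b i = B i * ((real n + 1) * p - real i) / s\<^sup>2"
      using True by (intro step) auto
    also have "\<dots> \<le> B i * \<bar>real i - (real n + 1) * p\<bar> / s\<^sup>2"
      using Bnn[of i] by (intro divide_right_mono mult_left_mono) auto
    finally show "b (Suc i) - b i \<le> B i * \<bar>real i - (real n + 1) * p\<bar> / s\<^sup>2" .
  qed
  \<comment> \<open>All terms are now nonnegative, so the sum may run over the whole range, where
    the moments are known.\<close>
  also have "\<dots> \<le> (\<Sum>i\<le>Suc n. B i * \<bar>real i - (real n + 1) * p\<bar> / s\<^sup>2)"
    using True Bnn by (intro sum_mono2) auto
  also have "\<dots> \<le> (\<Sum>i\<le>Suc n. B i * (((real i - (real n + 1) * p)\<^sup>2 / s + s) / 2) / s\<^sup>2)"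
    using Bnn by (intro sum_mono divide_right_mono mult_left_mono amgm) auto
  also have "\<dots> = ((\<Sum>i\<le>Suc n. B i * (real i - (real n + 1) * p)\<^sup>2) / s + s * (\<Sum>i\<le>Suc n. B i)) / 2 / s\<^sup>2"
    unfolding sum_divide_distrib sum_distrib_left sum.distrib[symmetric]
    by (intro sum.cong refl) (simp add: algebra_simps add_divide_distrib)
  also have "(\<Sum>i\<le>Suc n. B i) = 1"
    using sum_Bernstein[of "Suc n" p] by (simp only: B_def)
  also have "((\<Sum>i\<le>Suc n. B i * (real i - (real n + 1) * p)\<^sup>2) / s + s * 1) / 2 / s\<^sup>2 = 1 / s"
    unfolding var using s by (simp add: field_simps power2_eq_square)
  finally show ?thesis
    by (simp add: s_def)
qed (use p in \<open>simp add: Bernstein_def binomial_eq_0\<close>)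

definition antichain :: "'a set set \<Rightarrow> bool" where
  "antichain F \<longleftrightarrow> (\<forall>A\<in>F. \<forall>B\<in>F. \<not> A \<subset> B)"

text \<open>If \<open>A\<close> is a proper subset of \<open>E\<close>, its weight \<open>1 / (card E choose card A)\<close> is the average over \<open>x \<in> E\<close> of its weight inside
  \<open>E - {x}\<close>, counted as 0 when \<open>x \<in> A\<close>; so the inequality for \<open>E\<close> is an average of those for
  the sets \<open>E - {x}\<close>.\<close>

lemma LYM_inequality:
  assumes "finite E" "F \<subseteq> Pow E" "antichain F"
  shows "(\<Sum>A\<in>F. 1 / real (card E choose card A)) \<le> 1"
  using assms
proof (induction "card E" arbitrary: E F)
  case 0
  then have "F \<subseteq> {{}}" by auto
  then show ?case
    using "0.prems" "0.hyps"[symmetric] by (auto simp: subset_singleton_iff)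
next
  case (Suc n)
  show ?case
  proof (cases "E \<in> F")
    case True
    then have "F = {E}"
      using Suc.prems unfolding antichain_def by blast
    then show ?thesis by simp
  next
    case False
    have finF: "finite F"
      using Suc.prems by (meson finite_Pow_iff finite_subset)
    have weight: "1 / real (card E choose card A) = (\<Sum>x\<in>E - A. 1 / real (n choose card A)) / real (Suc n)"
      if A: "A \<in> F" for A
    proof -
      have "A \<subset> E" using A Suc.prems False by auto
      then have less: "card A < Suc n" and c: "card (E - A) = Suc n - card A"
        using Suc.prems psubset_card_mono[of E A] Suc.hyps(2)
        by (auto simp: card_Diff_subset finite_subset)
      have pos: "real (Suc n choose card A) > 0" "real (n choose card A) > 0"
        using less by auto
      have "real ((Suc n - card A) * (Suc n choose card A)) = real (Suc n * (n choose card A))"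
        using binomial_absorb_comp[of "Suc n" "card A"] by simp
      then have "real (Suc n - card A) * real (Suc n choose card A) = real (Suc n) * real (n choose card A)"
        by (simp only: of_nat_mult)
      moreover have "1 / x = k * (1 / y) / m" if "k * x = m * y" "x > 0" "y > 0" "m > 0" for k m x y :: real
        using that by (simp add: field_simps)
      ultimately show ?thesis
        using pos unfolding Suc.hyps(2)[symmetric] sum_constant c by simp
    qed
    have "(\<Sum>A\<in>F. 1 / real (card E choose card A))
        = (\<Sum>A\<in>F. \<Sum>x\<in>E - A. 1 / real (n choose card A)) / real (Suc n)"
      unfolding sum_divide_distrib[of _ F] by (intro sum.cong refl weight)
    also have "(\<Sum>A\<in>F. \<Sum>x\<in>E - A. 1 / real (n choose card A))
        = (\<Sum>A\<in>F. \<Sum>x | x \<in> E \<and> x \<notin> A. 1 / real (n choose card A))"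
      by (intro sum.cong refl) auto
    \<comment> \<open>After the swap, the inner sum is over an antichain of subsets of
      \<open>E - {x}\<close>.\<close>
    also have "\<dots> = (\<Sum>x\<in>E. \<Sum>A | A \<in> F \<and> x \<notin> A. 1 / real (n choose card A))"
      using Suc.prems finF by (intro sum.swap_restrict) auto
    also have "\<dots> \<le> (\<Sum>x\<in>E. 1)"
    proof (intro sum_mono)
      fix x assume x: "x \<in> E"
      have "n = card (E - {x})"
        using x Suc.prems Suc.hyps(2) by simp
      moreover from this have "(\<Sum>A | A \<in> F \<and> x \<notin> A. 1 / real (card (E - {x}) choose card A)) \<le> 1"
        using Suc.prems by (intro Suc.hyps(1)) (auto simp: antichain_def)
      ultimately show "(\<Sum>A | A \<in> F \<and> x \<notin> A. 1 / real (n choose card A)) \<le> 1"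
        by simp
    qed
    also have "(\<Sum>x\<in>E. 1 :: real) = real (Suc n)"
      using Suc.hyps(2) by simp
    finally show ?thesis by (simp add: divide_right_mono)
  qed
qed

section \<open>Random subsets with independent elements\<close>

text \<open>For \<open>E = vertex_pairs {1..n}\<close> this is the law of the edge set of
  \<open>binomial_random_graph n p\<close>.\<close>

definition random_subset :: "'a set \<Rightarrow> real \<Rightarrow> 'a set pmf" where
  "random_subset E p = map_pmf (\<lambda>c. {e \<in> E. c e}) (Pi_pmf E False (\<lambda>_. bernoulli_pmf p))"

lemma set_random_subset: "set_pmf (random_subset E p) \<subseteq> Pow E"
  by (auto simp: random_subset_def)

lemma pmf_random_subset:
  assumes "finite E" "A \<subseteq> E" "0 \<le> p" "p \<le> 1"
  shows "pmf (random_subset E p) A = p ^ card A * (1 - p) ^ (card E - card A)"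
proof -
  let ?c = "\<lambda>e. e \<in> A"
  have "pmf (random_subset E p) A
      = measure_pmf.prob (Pi_pmf E False (\<lambda>_. bernoulli_pmf p)) ((\<lambda>c. {e \<in> E. c e}) -` {A})"
    unfolding random_subset_def by (rule pmf_map)
  \<comment> \<open>Coins that differ only outside \<open>E\<close> give the same subset, but almost
    surely every coin there has the default value \<open>False\<close>, which leaves
    \<open>?c\<close> alone.\<close>
  also have "\<dots> = measure_pmf.prob (Pi_pmf E False (\<lambda>_. bernoulli_pmf p)) {?c}"
    using assms set_Pi_pmf_subset[OF assms(1), of False "\<lambda>_. bernoulli_pmf p"]
    by (intro measure_pmf.finite_measure_eq_AE) (auto simp: AE_measure_pmf_iff fun_eq_iff)
  also have "\<dots> = (\<Prod>e\<in>E. pmf (bernoulli_pmf p) (?c e))"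
    using assms by (subst measure_pmf_single, intro pmf_Pi') auto
  also have "\<dots> = (\<Prod>e\<in>A. pmf (bernoulli_pmf p) (?c e)) * (\<Prod>e\<in>E - A. pmf (bernoulli_pmf p) (?c e))"
    using assms by (simp add: prod.subset_diff mult.commute)
  also have "\<dots> = p ^ card A * (1 - p) ^ (card E - card A)"
    using assms by (simp add: card_Diff_subset finite_subset)
  finally show ?thesis .
qed

text \<open>The probability of a single set \<open>A\<close> is a binomial weight divided by
  \<open>card E choose card A\<close>. Bounding the weight uniformly leaves the LYM sum.\<close>

lemma prob_antichain_le:
  assumes "finite E" "F \<subseteq> Pow E" "antichain F" "0 < p" "p < 1"
  shows "measure_pmf.prob (random_subset E p) F \<le> 1 / sqrt ((real (card E) + 1) * p * (1 - p))"
proof -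
  let ?M = "1 / sqrt ((real (card E) + 1) * p * (1 - p))"
  have finF: "finite F"
    using assms by (meson finite_Pow_iff finite_subset)
  have "measure_pmf.prob (random_subset E p) F = (\<Sum>A\<in>F. pmf (random_subset E p) A)"
    by (rule measure_measure_pmf_finite[OF finF])
  also have "\<dots> \<le> (\<Sum>A\<in>F. ?M * (1 / real (card E choose card A)))"
  proof (intro sum_mono)
    fix A assume "A \<in> F"
    then have A: "A \<subseteq> E" using assms by auto
    then have pos: "real (card E choose card A) > 0"
      using assms by (auto simp: card_mono)
    have "pmf (random_subset E p) A = Bernstein (card E) (card A) p * (1 / real (card E choose card A))"
      using A assms pos by (simp add: pmf_random_subset Bernstein_def)
    also have "\<dots> \<le> ?M * (1 / real (card E choose card A))"
      using assms by (intro mult_right_mono Bernstein_le_inverse_sqrt) auto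
    finally show "pmf (random_subset E p) A \<le> ?M * (1 / real (card E choose card A))" .
  qed
  also have "\<dots> = ?M * (\<Sum>A\<in>F. 1 / real (card E choose card A))"
    by (rule sum_distrib_left[symmetric])
  also have "\<dots> \<le> ?M * 1"
    using assms by (intro mult_left_mono LYM_inequality) auto
  finally show ?thesis by simp
qed

section \<open>Cliques and copies through a new edge\<close>

lemma finite_vertex_pairs [simp]: "finite V \<Longrightarrow> finite (vertex_pairs V)"
  by (rule finite_subset[of _ "Pow V"]) (auto simp: vertex_pairs_def)

lemma card_vertex_pairs: "finite V \<Longrightarrow> card (vertex_pairs V) = card V choose 2"
  unfolding vertex_pairs_def by (rule n_subsets)

lemma pair_in_vertex_pairs [simp]: "{u, v} \<in> vertex_pairs V \<longleftrightarrow> u \<in> V \<and> v \<in> V \<and> u \<noteq> v"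
  by (auto simp: vertex_pairs_def card_insert_if)

lemma vertex_pairsE:
  assumes "e \<in> vertex_pairs V"
  obtains u v where "e = {u, v}" "u \<in> V" "v \<in> V" "u \<noteq> v"
  using assms unfolding vertex_pairs_def card_2_iff by auto

section \<open>Common neighbours and cliques\<close>

definition common_neighbours :: "'a set \<Rightarrow> 'a set set \<Rightarrow> 'a set \<Rightarrow> 'a set" where
  "common_neighbours V A S = {w \<in> V - S. \<forall>v\<in>S. {v, w} \<in> A}"

text \<open>Used with \<open>s = h - 1\<close>, the size of the largest clique that has to be
  extended, and with \<open>c\<close> linear in the number of vertices.\<close>

definition rich :: "'a set \<Rightarrow> nat \<Rightarrow> real \<Rightarrow> 'a set set \<Rightarrow> bool" where
  "rich V s c A \<longleftrightarrow> (\<forall>S\<subseteq>V. card S = s \<longrightarrow> c \<le> real (card (common_neighbours V A S)))"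

lemma common_neighbours_antimono:
  "S \<subseteq> T \<Longrightarrow> common_neighbours V A T \<subseteq> common_neighbours V A S"
  by (auto simp: common_neighbours_def)

text \<open>Enlarging \<open>S\<close> to a set of size exactly \<open>s\<close> can only lose
  common neighbours.\<close>

lemma rich_card_le:
  assumes "rich V s c A" "finite V" "s \<le> card V" "S \<subseteq> V" "card S \<le> s"
  shows "c \<le> real (card (common_neighbours V A S))"
proof -
  obtain T where T: "S \<subseteq> T" "T \<subseteq> V" "card T = s"
    using exists_subset_between[of S s V] assms by auto
  then have "c \<le> real (card (common_neighbours V A T))"
    using assms by (simp add: rich_def)
  also have "\<dots> \<le> real (card (common_neighbours V A S))"
    using common_neighbours_antimono[OF T(1)] assms
    by (intro of_nat_mono card_mono) (simp_all add: common_neighbours_def)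
  finally show ?thesis .
qed

text \<open>The pair \<open>e\<close> may be absent from \<open>A\<close>: these sets become cliques
  once \<open>e\<close> is added.\<close>

definition cliques_through :: "'a set \<Rightarrow> 'a set set \<Rightarrow> 'a set \<Rightarrow> nat \<Rightarrow> 'a set set" where
  "cliques_through V A e k = {W. W \<subseteq> V \<and> card W = k \<and> e \<subseteq> W \<and> vertex_pairs W \<subseteq> insert e A}"

lemma finite_cliques_through [simp]: "finite V \<Longrightarrow> finite (cliques_through V A e k)"
  by (rule finite_subset[of _ "Pow V"]) (auto simp: cliques_through_def)

lemma clique_insert_common_neighbour:
  assumes "finite V" "W \<in> cliques_through V A e k" "w \<in> common_neighbours V A W"
  shows "insert w W \<in> cliques_through V A e (Suc k)"
proof -
  have W: "W \<subseteq> V" "card W = k" "e \<subseteq> W" "vertex_pairs W \<subseteq> insert e A"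
    using assms by (auto simp: cliques_through_def)
  have w: "w \<in> V" "w \<notin> W" "\<forall>v\<in>W. {v, w} \<in> A"
    using assms by (auto simp: common_neighbours_def)
  have "vertex_pairs (insert w W) \<subseteq> insert e A"
  proof
    fix f assume "f \<in> vertex_pairs (insert w W)"
    then obtain u v where f: "f = {u, v}" "u \<in> insert w W" "v \<in> insert w W" "u \<noteq> v"
      by (rule vertex_pairsE)
    show "f \<in> insert e A"
    proof (cases "u = w \<or> v = w")
      case True
      then show ?thesis using f w by (auto simp: insert_commute)
    next
      case False
      then have "f \<in> vertex_pairs W" using f by auto
      then show ?thesis using W by auto
    qed
  qed
  moreover have "card (insert w W) = Suc k"
    using W w assms finite_subset by (subst card_insert_disjoint) auto
  ultimately show ?thesis
    using W w by (auto simp: cliques_through_def)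
qed

text \<open>Double counting of pairs of a \<open>k\<close>-clique \<open>W\<close> and a common
  neighbour \<open>w\<close> of it: there are at least \<open>c\<close> choices of \<open>w\<close>
  for each \<open>W\<close>, and each larger clique arises from at most \<open>k + 1\<close>
  pairs.\<close>

lemma card_cliques_through_step:
  assumes "rich V s c A" "finite V" "s \<le> card V" "k \<le> s"
  shows "c * real (card (cliques_through V A e k))
    \<le> real (Suc k) * real (card (cliques_through V A e (Suc k)))"
proof -
  let ?P = "SIGMA W:cliques_through V A e k. common_neighbours V A W"
  let ?Q = "SIGMA W:cliques_through V A e (Suc k). W"
  have finN: "finite (common_neighbours V A W)" for W
    using assms by (auto simp: common_neighbours_def)
  have finW: "finite W" "card W = Suc k" if "W \<in> cliques_through V A e (Suc k)" for W
    using that assms by (auto simp: cliques_through_def finite_subset)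
  have "c * real (card (cliques_through V A e k)) = (\<Sum>W\<in>cliques_through V A e k. c)"
    by simp
  also have "\<dots> \<le> (\<Sum>W\<in>cliques_through V A e k. real (card (common_neighbours V A W)))"
    using assms by (intro sum_mono rich_card_le[of V s]) (auto simp: cliques_through_def)
  also have "\<dots> = real (card ?P)"
    using assms finN by (subst card_SigmaI) auto
  also have "card ?P \<le> card ?Q"
  proof (rule card_inj_on_le)
    \<comment> \<open>As \<open>w\<close> lies outside \<open>W\<close>, removing it from the larger
      clique recovers \<open>W\<close>.\<close>
    show "inj_on (\<lambda>(W, w). (insert w W, w)) ?P"
      by (auto simp: inj_on_def common_neighbours_def dest!: insert_ident[THEN iffD1, rotated 2])
    show "(\<lambda>(W, w). (insert w W, w)) ` ?P \<subseteq> ?Q"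
      using clique_insert_common_neighbour[OF assms(2)] by auto
    show "finite ?Q"
      using assms finW by auto
  qed
  also have "card ?Q = (\<Sum>W\<in>cliques_through V A e (Suc k). Suc k)"
    using assms finW by (subst card_SigmaI) auto
  finally show ?thesis
    by (simp add: algebra_simps)
qed

text \<open>Starting from \<open>e\<close> itself, each of the \<open>j\<close> added vertices
  contributes a factor \<open>c\<close> divided by the new clique size.\<close>

lemma card_cliques_through_ge:
  assumes "rich V s c A" "finite V" "s \<le> card V" "e \<in> vertex_pairs V" "0 \<le> c" "Suc j \<le> s"
  shows "c ^ j / fact (j + 2) \<le> real (card (cliques_through V A e (j + 2)))"
  using assms(6)
proof (induction j)
  case 0
  have "W = e" if "e \<subseteq> W" "card W = 2" for W
    using that assms(4) card_subset_eq[of W e] card.infinite[of W]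
    by (fastforce simp: vertex_pairs_def)
  then have "e \<in> cliques_through V A e 2"
    using assms(4) by (force simp: cliques_through_def vertex_pairs_def card_2_iff doubleton_eq_iff)
  then have "card (cliques_through V A e 2) \<noteq> 0"
    using assms(2) by auto
  then have "1 \<le> real (card (cliques_through V A e 2))"
    by linarith
  then show ?case by (simp add: numeral_2_eq_2)
next
  case (Suc j)
  have "c ^ Suc j / fact (j + 2) = c * (c ^ j / fact (j + 2))"
    by simp
  also have "\<dots> \<le> c * real (card (cliques_through V A e (j + 2)))"
    using Suc assms by (intro mult_left_mono) auto
  also have "\<dots> \<le> real (Suc (j + 2)) * real (card (cliques_through V A e (Suc (j + 2))))"
    using Suc.prems assms by (intro card_cliques_through_step) auto
  finally have "c ^ Suc j / fact (j + 2) / real (Suc (j + 2)) \<le> real (card (cliques_through V A e (Suc (j + 2))))"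
    by (subst pos_divide_le_eq) (simp_all only: mult.commute of_nat_0_less_iff zero_less_Suc)
  moreover have "c ^ Suc j / fact (j + 2) / real (Suc (j + 2)) = c ^ Suc j / fact (Suc j + 2)"
    by (simp only: add_Suc fact_Suc divide_divide_eq_left mult.commute)
  ultimately show ?case
    by (simp only: add_Suc)
qed

section \<open>Copies created by a new edge\<close>

lemma finite_copies:
  assumes "finite V" "A \<subseteq> vertex_pairs V"
  shows "finite (copies H (V, A))"
  by (rule finite_subset[of _ "Pow V \<times> Pow A"])
    (use assms in \<open>auto simp: copies_def subgraph_def finite_subset\<close>)

text \<open>A bijection of the vertex sets can be chosen to send a given edge of \<open>H\<close> to
  \<open>e\<close> and the other vertices arbitrarily; \<open>F\<close> is the image of the edges of
  \<open>H\<close>.\<close>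

lemma copy_on_clique:
  assumes H: "finite_simple_graph H" and u0v0: "{u0, v0} \<in> edges H"
    and e: "e = {a, b}" "a \<noteq> b" and W: "finite W" "card W = card (verts H)" "e \<subseteq> W"
  shows "\<exists>F. e \<in> F \<and> F \<subseteq> vertex_pairs W \<and> graph_iso H (W, F)"
proof -
  have EH: "edges H \<subseteq> vertex_pairs (verts H)" and finH: "finite (verts H)"
    using H by (auto simp: finite_simple_graph_def)
  have uv: "u0 \<in> verts H" "v0 \<in> verts H" "u0 \<noteq> v0"
    using subsetD[OF EH u0v0] unfolding pair_in_vertex_pairs by auto
  have ab: "a \<in> W" "b \<in> W" using W e by auto
  have "card (verts H - {u0, v0}) = card (W - {a, b})"
    using uv ab e W finH by (simp add: card_Diff_subset)
  then obtain g where g: "bij_betw g (verts H - {u0, v0}) (W - {a, b})"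
    using finite_same_card_bij[of "verts H - {u0, v0}" "W - {a, b}"] finH W by auto
  define f where "f = (\<lambda>x. if x = u0 then a else if x = v0 then b else g x)"
  have "bij_betw f (verts H - {u0, v0}) (W - {a, b})"
    using g by (subst bij_betw_cong[where g = g]) (auto simp: f_def)
  moreover have "bij_betw f {u0, v0} {a, b}"
    using uv e by (auto simp: f_def bij_betw_def inj_on_def)
  ultimately have "bij_betw f ((verts H - {u0, v0}) \<union> {u0, v0}) ((W - {a, b}) \<union> {a, b})"
    by (rule bij_betw_combine) auto
  moreover have "(verts H - {u0, v0}) \<union> {u0, v0} = verts H" "(W - {a, b}) \<union> {a, b} = W"
    using uv ab by auto
  ultimately have bij: "bij_betw f (verts H) W" by simp
  let ?F = "(`) f ` edges H"
  have "f ` {u0, v0} = e" using e uv by (auto simp: f_def)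
  then have "e \<in> ?F" using u0v0 by blast
  moreover have "?F \<subseteq> vertex_pairs W"
  proof
    fix x assume "x \<in> ?F"
    then obtain d where "d \<in> edges H" "x = f ` d" by auto
    then obtain u v where "x = {f u, f v}" "u \<in> verts H" "v \<in> verts H" "u \<noteq> v"
      using EH by (auto elim!: vertex_pairsE dest!: subsetD)
    then show "x \<in> vertex_pairs W"
      using bij by (auto simp: bij_betw_def inj_on_def)
  qed
  moreover have "{u, v} \<in> edges H \<longleftrightarrow> {f u, f v} \<in> ?F" if "u \<in> verts H" "v \<in> verts H" for u v
  proof
    assume "{u, v} \<in> edges H"
    then have "f ` {u, v} \<in> ?F" by (rule imageI)
    then show "{f u, f v} \<in> ?F" by simp
  next
    assume "{f u, f v} \<in> ?F"
    then obtain d where d: "d \<in> edges H" "f ` {u, v} = f ` d" by auto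
    moreover have "d \<subseteq> verts H" using d EH by (auto simp: vertex_pairs_def)
    ultimately have "{u, v} = d"
      using that bij inj_on_image_eq_iff[of f "verts H" "{u, v}" d] by (auto simp: bij_betw_def)
    then show "{u, v} \<in> edges H" using d by simp
  qed
  ultimately show ?thesis
    using bij by (intro exI[of _ ?F]) (auto simp: graph_iso_def)
qed

lemma num_copies_mono:
  assumes "finite V" "A \<subseteq> B" "B \<subseteq> vertex_pairs V"
  shows "num_copies H (V, A) \<le> num_copies H (V, B)"
  unfolding num_copies_def using assms
  by (intro card_mono finite_copies) (auto simp: copies_def subgraph_def)

text \<open>One copy is chosen on each clique through \<open>e\<close>. These copies differ in their
  vertex sets, and they are new because they use \<open>e\<close>.\<close>

lemma num_copies_insert_edge:
  assumes H: "finite_simple_graph H" "edges H \<noteq> {}"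
    and V: "finite V" "A \<subseteq> vertex_pairs V" "e \<in> vertex_pairs V" "e \<notin> A"
  shows "num_copies H (V, A) + card (cliques_through V A e (card (verts H)))
    \<le> num_copies H (V, insert e A)"
proof -
  let ?C = "cliques_through V A e (card (verts H))"
  obtain u0 v0 where u0v0: "{u0, v0} \<in> edges H"
    using H by (fastforce simp: finite_simple_graph_def elim!: vertex_pairsE)
  obtain a b where ab: "e = {a, b}" "a \<noteq> b"
    using V(3) by (rule vertex_pairsE)
  have "\<forall>W\<in>?C. \<exists>F. e \<in> F \<and> F \<subseteq> vertex_pairs W \<and> graph_iso H (W, F)"
    using copy_on_clique[OF H(1) u0v0 ab] V(1) by (auto simp: cliques_through_def finite_subset)
  then obtain F where F: "\<And>W. W \<in> ?C \<Longrightarrow> e \<in> F W \<and> F W \<subseteq> vertex_pairs W \<and> graph_iso H (W, F W)"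
    by metis
  let ?N = "(\<lambda>W. (W, F W)) ` ?C"
  have "card (copies H (V, A)) + card ?C = card (copies H (V, A)) + card ?N"
    by (simp add: card_image inj_on_def)
  also have "\<dots> = card (copies H (V, A) \<union> ?N)"
  proof (rule card_Un_disjoint[symmetric])
    show "copies H (V, A) \<inter> ?N = {}"
      using F V(4) by (fastforce simp: copies_def subgraph_def)
  qed (simp_all add: V finite_copies)
  also have "\<dots> \<le> card (copies H (V, insert e A))"
  proof (intro card_mono finite_copies Un_least)
    show "copies H (V, A) \<subseteq> copies H (V, insert e A)"
      by (auto simp: copies_def subgraph_def)
    show "?N \<subseteq> copies H (V, insert e A)"
    proof safe
      fix W assume W: "W \<in> ?C"
      then have "W \<subseteq> V" "vertex_pairs W \<subseteq> insert e A" "finite W"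
        using V by (auto simp: cliques_through_def finite_subset)
      then show "(W, F W) \<in> copies H (V, insert e A)"
        using F[OF W] by (auto simp: copies_def subgraph_def finite_simple_graph_def)
    qed
  qed (use V in auto)
  finally show ?thesis by (simp add: num_copies_def)
qed

text \<open>A single edge of \<open>B - A\<close> already yields the gain, and further edges destroy
  no copies. Hence richness is asked of the smaller set only.\<close>

lemma num_copies_increment:
  assumes H: "finite_simple_graph H" "edges H \<noteq> {}" "card (verts H) = h"
    and V: "finite V" "h - 1 \<le> card V" and AB: "A \<subset> B" "B \<subseteq> vertex_pairs V"
    and rich: "rich V (h - 1) c A" and c: "0 \<le> c"
  shows "real (num_copies H (V, A)) + c ^ (h - 2) / fact h \<le> real (num_copies H (V, B))"
proof -
  obtain d where "d \<in> edges H" using H by auto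
  then have "card d = 2" "d \<subseteq> verts H" "finite (verts H)"
    using H by (auto simp: finite_simple_graph_def vertex_pairs_def)
  \<comment> \<open>This makes the truncated subtraction \<open>h - 2\<close> a true one.\<close>
  then have h: "h \<ge> 2" using H card_mono[of "verts H" d] by simp
  obtain e where e: "e \<in> B" "e \<notin> A" using AB by auto
  have "c ^ (h - 2) / fact (h - 2 + 2) \<le> real (card (cliques_through V A e (h - 2 + 2)))"
    using rich V c e AB h by (intro card_cliques_through_ge) auto
  moreover have "h - 2 + 2 = h" using h by simp
  ultimately have "c ^ (h - 2) / fact h \<le> real (card (cliques_through V A e h))"
    by (simp only:)
  then have "real (num_copies H (V, A)) + c ^ (h - 2) / fact h
      \<le> real (num_copies H (V, A) + card (cliques_through V A e h))"
    by simp
  also have "\<dots> \<le> real (num_copies H (V, insert e A))"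
    using num_copies_insert_edge[OF H(1,2) V(1) _ _ e(2)] AB e H(3) by (intro of_nat_mono) blast
  also have "\<dots> \<le> real (num_copies H (V, B))"
    using AB e V by (intro of_nat_mono num_copies_mono) auto
  finally show ?thesis .
qed

section \<open>Anti-concentration of the number of copies\<close>

lemma prob_Pi_bernoulli_all:
  assumes "finite E" "K \<subseteq> E" "0 \<le> p" "p \<le> 1"
  shows "measure_pmf.prob (Pi_pmf E d (\<lambda>_. bernoulli_pmf p)) {c. \<forall>f\<in>K. c f} = p ^ card K"
proof -
  have "{c. \<forall>f\<in>K. c f} = Pi E (\<lambda>f. if f \<in> K then {True} else UNIV)"
    using assms by (auto simp: Pi_def)
  then have "measure_pmf.prob (Pi_pmf E d (\<lambda>_. bernoulli_pmf p)) {c. \<forall>f\<in>K. c f}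
      = (\<Prod>f\<in>E. if f \<in> K then p else 1)"
    using assms by (simp add: measure_Pi_pmf_Pi measure_pmf_single if_distrib cong: if_cong)
  also have "\<dots> = p ^ card K"
    using assms by (simp add: prod.If_cases Int_absorb1)
  finally show ?thesis .
qed

text \<open>Different vertices \<open>w\<close> outside \<open>S\<close> are joined to
  \<open>S\<close> by disjoint sets of pairs, so the events that \<open>w\<close> is a common
  neighbour are independent, each of probability \<open>p ^ card S\<close>. Hoeffding's inequality
  is applied with half the mean as deviation.\<close>

lemma prob_few_common_neighbours:
  assumes V: "finite V" and S: "S \<subset> V" and p: "0 < p" "p < 1"
  defines "m \<equiv> real (card (V - S))"
  shows "measure_pmf.prob (random_subset (vertex_pairs V) p)
      {A. real (card (common_neighbours V A S)) \<le> p ^ card S * m / 2}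
    \<le> exp (- ((p ^ card S)\<^sup>2 * m / 2))"
proof -
  define E where "E = vertex_pairs V"
  define P where "P = Pi_pmf E False (\<lambda>_. bernoulli_pmf p)"
  define K where "K = (\<lambda>w. (\<lambda>v. {v, w}) ` S)"
  \<comment> \<open>The indicator that \<open>w\<close> is a common neighbour; as a product over
    \<open>K w\<close> it is measurable factor by factor and depends only on the coins in
    \<open>K w\<close>.\<close>
  define X :: "'a \<Rightarrow> ('a set \<Rightarrow> bool) \<Rightarrow> real"
    where "X = (\<lambda>w c. \<Prod>f\<in>K w. of_bool (c f))"
  let ?q = "p ^ card S"
  have finE: "finite E" using V by (simp add: E_def)
  have finS: "finite S" using V S by (auto intro: finite_subset)
  then have finK: "finite (K w)" for w by (simp add: K_def)
  have K: "K w \<subseteq> E" "card (K w) = card S" if "w \<in> V - S" for w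
  proof -
    have "inj_on (\<lambda>v. {v, w}) S"
      using that by (auto simp: inj_on_def doubleton_eq_iff)
    then show "card (K w) = card S" by (simp add: K_def card_image)
    show "K w \<subseteq> E" using that S by (auto simp: K_def E_def)
  qed
  have m: "m > 0"
    using S V unfolding m_def by (auto simp: card_gt_0_iff)
  have X_eq: "X w = indicator {c. \<forall>f\<in>K w. c f}" for w
    using finK[of w] by (auto simp: X_def indicator_def fun_eq_iff)
  have EX: "measure_pmf.expectation P (X w) = ?q" if "w \<in> V - S" for w
    using K[OF that] finE p by (simp add: X_eq P_def prob_Pi_bernoulli_all)
  have indep: "prob_space.indep_vars (measure_pmf P) (\<lambda>_. borel) X (V - S)"
  proof -
    have disj: "disjoint_family_on K (V - S)"
      unfolding disjoint_family_on_def K_def by (auto simp: doubleton_eq_iff)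
    have "prob_space.indep_vars (measure_pmf P) (\<lambda>w. Pi\<^sub>M (K w) (\<lambda>_. count_space UNIV))
        (\<lambda>w c. restrict c (K w)) (V - S)"
      using prob_space.indep_vars_restrict[OF measure_pmf.prob_space_axioms
          indep_vars_Pi_pmf[OF finE, of False "\<lambda>_. bernoulli_pmf p"], of "V - S" K] K(1) disj
      by (simp add: P_def)
    then have "prob_space.indep_vars (measure_pmf P) (\<lambda>_. borel)
        (\<lambda>w c. (\<Prod>f\<in>K w. of_bool (restrict c (K w) f)) :: real) (V - S)"
    proof (rule prob_space.indep_vars_compose2[OF measure_pmf.prob_space_axioms,
        where Y = "\<lambda>w g. (\<Prod>f\<in>K w. of_bool (g f)) :: real"])
      fix w
      show "(\<lambda>g. (\<Prod>f\<in>K w. of_bool (g f)) :: real)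
          \<in> borel_measurable (Pi\<^sub>M (K w) (\<lambda>_. count_space UNIV))"
        by (intro borel_measurable_prod measurable_compose[OF measurable_component_singleton]) auto
    qed
    moreover have "(\<lambda>w c. (\<Prod>f\<in>K w. of_bool (restrict c (K w) f)) :: real) = X"
      by (auto simp: X_def fun_eq_iff intro!: prod.cong)
    ultimately show ?thesis by simp
  qed
  interpret Hoeffding_ineq "measure_pmf P" "V - S" X "\<lambda>_. 0" "\<lambda>_. 1" "m * ?q"
  proof unfold_locales
    show "m * ?q \<equiv> (\<Sum>w\<in>V - S. measure_pmf.expectation P (X w))"
      by (rule eq_reflection) (simp add: EX m_def)
  qed (use V indep in \<open>auto simp: X_eq indicator_def\<close>)
  have count: "real (card (common_neighbours V {e \<in> E. c e} S)) = (\<Sum>w\<in>V - S. X w c)" for c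
  proof -
    have "common_neighbours V {e \<in> E. c e} S = {w \<in> V - S. \<forall>f\<in>K w. c f}"
      using S by (auto simp: common_neighbours_def E_def K_def)
    then show ?thesis
      using V by (simp add: X_eq indicator_def sum.If_cases Int_def)
  qed
  have "measure_pmf.prob (random_subset (vertex_pairs V) p)
      {A. real (card (common_neighbours V A S)) \<le> ?q * m / 2}
    = measure_pmf.prob P {c. (\<Sum>w\<in>V - S. X w c) \<le> m * ?q - ?q * m / 2}"
    unfolding random_subset_def E_def[symmetric] P_def[symmetric]
    by (simp add: vimage_def count algebra_simps)
  also have "\<dots> \<le> exp (- 2 * (?q * m / 2)\<^sup>2 / (\<Sum>w\<in>V - S. (1 - 0)\<^sup>2))"
    using Hoeffding_ineq_le[of "?q * m / 2"] m p by (simp add: m_def)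
  also have "\<dots> = exp (- (?q\<^sup>2 * m / 2))"
    using m by (simp add: m_def[symmetric] power2_eq_square)
  finally show ?thesis .
qed

text \<open>A union bound over the sets \<open>S\<close> of size \<open>s\<close>. At least half of
  the vertices lie outside \<open>S\<close>, so the threshold with factor \<open>p ^ s / 4\<close>
  is at most half the expected number of common neighbours.\<close>

lemma prob_not_rich:
  assumes V: "finite V" "2 * s \<le> card V" "0 < card V" and p: "0 < p" "p < 1"
  shows "measure_pmf.prob (random_subset (vertex_pairs V) p) {A. \<not> rich V s (p ^ s / 4 * real (card V)) A}
    \<le> real (card V) ^ s * exp (- ((p ^ s)\<^sup>2 / 4 * real (card V)))"
proof -
  let ?n = "real (card V)"
  let ?S = "{S. S \<subseteq> V \<and> card S = s}"
  let ?B = "\<lambda>S. {A. real (card (common_neighbours V A S)) \<le> p ^ card S * real (card (V - S)) / 2}"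
  let ?P = "random_subset (vertex_pairs V) p"
  have finS: "finite ?S" using V by simp
  have half: "?n / 2 \<le> real (card (V - S))" if "S \<in> ?S" for S
  proof -
    have "card (V - S) = card V - s"
      using that V by (auto simp: card_Diff_subset finite_subset)
    then show ?thesis using V by linarith
  qed
  have "{A. \<not> rich V s (p ^ s / 4 * ?n) A} \<subseteq> (\<Union>S\<in>?S. ?B S)"
  proof
    fix A assume "A \<in> {A. \<not> rich V s (p ^ s / 4 * ?n) A}"
    then obtain S where S: "S \<in> ?S" and less: "real (card (common_neighbours V A S)) < p ^ s / 4 * ?n"
      by (auto simp: rich_def not_le)
    have "p ^ s / 4 * ?n = p ^ s * (?n / 2) / 2" by simp
    also have "\<dots> \<le> p ^ s * real (card (V - S)) / 2"
      using half[OF S] p by (intro divide_right_mono mult_left_mono) auto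
    finally have "real (card (common_neighbours V A S)) \<le> p ^ s * real (card (V - S)) / 2"
      using less by linarith
    then have "A \<in> ?B S"
      using S by simp
    then show "A \<in> (\<Union>S\<in>?S. ?B S)"
      using S by blast
  qed
  then have "measure_pmf.prob ?P {A. \<not> rich V s (p ^ s / 4 * ?n) A} \<le> measure_pmf.prob ?P (\<Union>S\<in>?S. ?B S)"
    by (intro measure_pmf.finite_measure_mono) auto
  also have "\<dots> \<le> (\<Sum>S\<in>?S. measure_pmf.prob ?P (?B S))"
    using finS by (intro measure_pmf.finite_measure_subadditive_finite) auto
  also have "\<dots> \<le> (\<Sum>S\<in>?S. exp (- ((p ^ s)\<^sup>2 / 4 * ?n)))"
  proof (intro sum_mono)
    fix S assume S: "S \<in> ?S"
    then have "S \<subset> V" using V by auto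
    then have "measure_pmf.prob ?P (?B S) \<le> exp (- ((p ^ card S)\<^sup>2 * real (card (V - S)) / 2))"
      using V p by (intro prob_few_common_neighbours) auto
    also have "\<dots> \<le> exp (- ((p ^ s)\<^sup>2 / 4 * ?n))"
      using mult_left_mono[OF half[OF S], of "(p ^ s)\<^sup>2"] S by (simp add: mult_ac)
    finally show "measure_pmf.prob ?P (?B S) \<le> exp (- ((p ^ s)\<^sup>2 / 4 * ?n))" .
  qed
  also have "\<dots> = real (card V choose s) * exp (- ((p ^ s)\<^sup>2 / 4 * ?n))"
    using V by (simp add: n_subsets)
  also have "\<dots> \<le> ?n ^ s * exp (- ((p ^ s)\<^sup>2 / 4 * ?n))"
    using binomial_le_pow[of s "card V"] V
    by (intro mult_right_mono) (auto simp flip: of_nat_power intro!: of_nat_mono)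
  finally show ?thesis .
qed

lemma power_times_exp_bounded:
  fixes a :: real
  assumes "a > 0"
  obtains K where "K > 0" "\<And>n. real n ^ k * exp (- (a * real n)) \<le> K"
proof -
  have "(\<lambda>n. real n ^ k * exp (- (a * real n))) \<longlonglongrightarrow> 0"
    using assms by real_asymp
  then have "Bseq (\<lambda>n. real n ^ k * exp (- (a * real n)))"
    by (intro convergent_imp_Bseq convergentI)
  then obtain K where "K > 0" "\<forall>n. norm (real n ^ k * exp (- (a * real n))) \<le> K"
    by (rule BseqE)
  then show ?thesis using that[of K] by (auto simp: abs_mult)
qed

section \<open>From antichains to small-ball probabilities\<close>

text \<open>The interval around \<open>x\<close> is cut into levels of length \<open>d\<close>.
  Passing from a set in \<open>R\<close> to a proper superset raises \<open>f\<close> by at least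
  \<open>d\<close>, hence raises the level, so each level is an antichain.\<close>

lemma prob_small_ball_le:
  fixes f :: "'a set \<Rightarrow> real"
  assumes E: "finite E" and p: "0 < p" "p < 1" and d: "0 < d" "0 \<le> M"
    and inc: "\<And>A B. A \<in> R \<Longrightarrow> A \<subset> B \<Longrightarrow> B \<subseteq> E \<Longrightarrow> f A + d \<le> f B"
  shows "measure_pmf.prob (random_subset E p) {A \<in> R. \<bar>f A - x\<bar> \<le> M}
    \<le> (2 * M / d + 1) * (1 / sqrt ((real (card E) + 1) * p * (1 - p)))"
proof -
  let ?P = "random_subset E p"
  let ?b = "1 / sqrt ((real (card E) + 1) * p * (1 - p))"
  define level where "level = (\<lambda>A. nat \<lfloor>(f A - (x - M)) / d\<rfloor>)"
  define L where "L = nat \<lfloor>2 * M / d\<rfloor>"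
  define F where "F = (\<lambda>i. {A. A \<subseteq> E \<and> A \<in> R \<and> \<bar>f A - x\<bar> \<le> M \<and> level A = i})"
  have anti: "antichain (F i)" for i
    unfolding antichain_def
  proof (intro ballI notI)
    fix A B assume A: "A \<in> F i" and B: "B \<in> F i" and "A \<subset> B"
    then have "f A + d \<le> f B" by (intro inc) (auto simp: F_def)
    then have "(f A + d - (x - M)) / d \<le> (f B - (x - M)) / d"
      using d by (intro divide_right_mono) auto
    moreover have "(f A + d - (x - M)) / d = (f A - (x - M)) / d + 1"
      using d by (simp add: diff_divide_distrib add_divide_distrib)
    ultimately have "(f A - (x - M)) / d + 1 \<le> (f B - (x - M)) / d"
      by simp
    \<comment> \<open>Nonnegativity keeps \<open>nat\<close> from merging different levels.\<close>
    moreover have "0 \<le> (f A - (x - M)) / d"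
      using A d by (auto simp: F_def)
    ultimately have "level A < level B"
      unfolding level_def by linarith
    then show False using A B by (simp add: F_def)
  qed
  have "measure_pmf.prob ?P {A \<in> R. \<bar>f A - x\<bar> \<le> M}
      = measure_pmf.prob ?P ({A \<in> R. \<bar>f A - x\<bar> \<le> M} \<inter> set_pmf ?P)"
    by (rule measure_Int_set_pmf[symmetric])
  also have "\<dots> \<le> measure_pmf.prob ?P (\<Union>i\<le>L. F i)"
  proof (intro measure_pmf.finite_measure_mono)
    have "level A \<le> L" if "\<bar>f A - x\<bar> \<le> M" for A
      unfolding level_def L_def using that d
      by (intro nat_mono floor_mono divide_right_mono) auto
    then show "{A \<in> R. \<bar>f A - x\<bar> \<le> M} \<inter> set_pmf ?P \<subseteq> (\<Union>i\<le>L. F i)"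
      using set_random_subset[of E p] by (auto simp: F_def)
  qed simp
  also have "\<dots> \<le> (\<Sum>i\<le>L. measure_pmf.prob ?P (F i))"
    by (intro measure_pmf.finite_measure_subadditive_finite) auto
  also have "\<dots> \<le> (\<Sum>i\<le>L. ?b)"
    using E p anti by (intro sum_mono prob_antichain_le) (auto simp: F_def)
  also have "\<dots> = (real L + 1) * ?b" by simp
  also have "\<dots> \<le> (2 * M / d + 1) * ?b"
  proof (intro mult_right_mono add_right_mono)
    have "0 \<le> 2 * M / d" using d by simp
    then show "real L \<le> 2 * M / d" unfolding L_def by linarith
  qed (use p in auto)
  finally show ?thesis .
qed

text \<open>The number of pairs is quadratic in the number of vertices, which turns the inverse
  square root into an inverse.\<close>

lemma inverse_sqrt_vertex_pairs_le:
  assumes "finite V" "0 < card V" "0 < p" "p < 1"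
  shows "1 / sqrt ((real (card (vertex_pairs V)) + 1) * p * (1 - p)) \<le> 2 / sqrt (p * (1 - p)) / real (card V)"
proof -
  let ?n = "real (card V)"
  have "2 * (card V choose 2) = card V * (card V - 1)"
    unfolding choose_two by (rule dvd_mult_div_cancel) (cases "card V"; simp)
  then have "2 * real (card V choose 2) = ?n * real (card V - 1)"
    by (metis of_nat_mult of_nat_numeral)
  then have "2 * real (card V choose 2) = ?n * (?n - 1)"
    using assms by simp
  moreover have "0 \<le> (?n - 1)\<^sup>2" by simp
  ultimately have "?n\<^sup>2 / 4 \<le> real (card (vertex_pairs V)) + 1"
    using assms by (simp add: card_vertex_pairs power2_eq_square algebra_simps)
  then have "?n\<^sup>2 / 4 * (p * (1 - p)) \<le> (real (card (vertex_pairs V)) + 1) * (p * (1 - p))"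
    using assms by (intro mult_right_mono) auto
  then have "sqrt (?n\<^sup>2 / 4 * (p * (1 - p))) \<le> sqrt ((real (card (vertex_pairs V)) + 1) * p * (1 - p))"
    by (simp add: mult.assoc)
  moreover have "sqrt (?n\<^sup>2 / 4 * (p * (1 - p))) = ?n / 2 * sqrt (p * (1 - p))"
    by (simp add: real_sqrt_mult real_sqrt_divide)
  ultimately have "?n / 2 * sqrt (p * (1 - p)) \<le> sqrt ((real (card (vertex_pairs V)) + 1) * p * (1 - p))"
    by (simp only:)
  then have "1 / sqrt ((real (card (vertex_pairs V)) + 1) * p * (1 - p)) \<le> 1 / (?n / 2 * sqrt (p * (1 - p)))"
    by (rule divide_left_mono) (use assms in auto)
  then show ?thesis by (simp add: field_simps)
qed

theorem theorem1p13:
  fixes p :: real and H :: "'a ugraph" and h :: nat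
  assumes "0 < p" and "p < 1"
    and "finite_simple_graph H" and "card (verts H) = h" and "edges H \<noteq> {}"
  shows "\<exists>C::real. \<forall>n::nat. n \<ge> 1 \<longrightarrow> (\<forall>x::nat.
           measure_pmf.prob (binomial_random_graph n p)
             {G. \<bar>real (num_copies H G) - real x\<bar> \<le> real n ^ (h - 2)} \<le> C / real n)"
proof -
  define s where "s = h - 1"
  define a where "a = p ^ s / 4"
  \<comment> \<open>This is \<open>2 * M / d + 1\<close> for the \<open>M\<close> and
    \<open>d\<close> below, in which the powers of \<open>n\<close> cancel.\<close>
  define L where "L = 2 * fact h / a ^ (h - 2) + 1"
  have a: "a > 0" using assms by (simp add: a_def)
  have "(p ^ s)\<^sup>2 / 4 > 0" using assms by simp
  \<comment> \<open>The exponent \<open>Suc s\<close> has one factor \<open>n\<close> to spare, so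
    the probability of not being rich is at most \<open>K / n\<close>.\<close>
  then obtain K where K: "K > 0" "\<And>n. real n ^ Suc s * exp (- ((p ^ s)\<^sup>2 / 4 * real n)) \<le> K"
    using power_times_exp_bounded[of "(p ^ s)\<^sup>2 / 4" "Suc s"] by blast
  have L: "L > 0" using a by (simp add: L_def add_pos_pos)
  \<comment> \<open>The summand \<open>2 * real h\<close> makes the claim trivial for
    \<open>n < 2 * h\<close>; \<open>K\<close> pays for the graphs that are not rich, and the last
    summand for the levels.\<close>
  define C where "C = 2 * real h + K + L * (2 / sqrt (p * (1 - p)))"
  have C: "2 * real h \<le> C" "K + L * (2 / sqrt (p * (1 - p))) \<le> C"
    using K L assms by (auto simp: C_def)
  show ?thesis
  proof (intro exI[of _ C] allI impI)
    fix n x :: nat assume n: "n \<ge> 1"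
    define V where "V = {1..n}"
    define E where "E = vertex_pairs V"
    have V: "finite V" "card V = n" by (auto simp: V_def)
    define f where "f = (\<lambda>A. real (num_copies H (V, A)))"
    define M where "M = real n ^ (h - 2)"
    define d where "d = (a * real n) ^ (h - 2) / fact h"
    define R where "R = {A. rich V s (a * real n) A}"
    let ?P = "random_subset E p"
    \<comment> \<open>Only the edge set is random, so the event can be moved to
      \<open>random_subset\<close>.\<close>
    have "binomial_random_graph n p = map_pmf (Pair V) ?P"
      by (simp add: binomial_random_graph_def random_subset_def V_def E_def pmf.map_comp o_def)
    then have eq: "measure_pmf.prob (binomial_random_graph n p)
        {G. \<bar>real (num_copies H G) - real x\<bar> \<le> real n ^ (h - 2)}
      = measure_pmf.prob ?P {A. \<bar>f A - real x\<bar> \<le> M}"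
      by (simp add: vimage_def f_def M_def)
    show "measure_pmf.prob (binomial_random_graph n p)
        {G. \<bar>real (num_copies H G) - real x\<bar> \<le> real n ^ (h - 2)} \<le> C / real n"
    proof (cases "n < 2 * h")
      case True
      then have "1 \<le> C / real n"
        using C n by (simp add: le_divide_eq)
      then show ?thesis
        using measure_pmf.prob_le_1 order_trans by blast
    next
      case False
      have d: "d > 0" using a n by (simp add: d_def)
      have inc: "f A + d \<le> f B" if "A \<in> R" "A \<subset> B" "B \<subseteq> E" for A B
        unfolding f_def d_def
        using that assms a V False
        by (intro num_copies_increment) (auto simp: R_def s_def E_def)
      have "measure_pmf.prob ?P {A. \<bar>f A - real x\<bar> \<le> M}
          \<le> measure_pmf.prob ?P ({A. \<not> rich V s (a * real n) A} \<union> {A \<in> R. \<bar>f A - real x\<bar> \<le> M})"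
        by (intro measure_pmf.finite_measure_mono) (auto simp: R_def)
      also have "\<dots> \<le> measure_pmf.prob ?P {A. \<not> rich V s (a * real n) A}
          + measure_pmf.prob ?P {A \<in> R. \<bar>f A - real x\<bar> \<le> M}"
        by (rule measure_Un_le) auto
      also have "\<dots> \<le> K / real n + L * (2 / sqrt (p * (1 - p))) / real n"
      proof (rule add_mono)
        have "measure_pmf.prob ?P {A. \<not> rich V s (a * real n) A}
            \<le> real n ^ s * exp (- ((p ^ s)\<^sup>2 / 4 * real n))"
          using prob_not_rich[of V s p] V n assms False by (simp add: a_def s_def E_def)
        also have "\<dots> \<le> K / real n"
          using K(2)[of n] n by (simp add: field_simps)
        finally show "measure_pmf.prob ?P {A. \<not> rich V s (a * real n) A} \<le> K / real n" .
        have "2 * M / d + 1 = L"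
          using a n by (simp add: M_def d_def L_def power_mult_distrib)
        then have "measure_pmf.prob ?P {A \<in> R. \<bar>f A - real x\<bar> \<le> M}
            \<le> L * (1 / sqrt ((real (card E) + 1) * p * (1 - p)))"
          using prob_small_ball_le[of E p d M R f "real x"] V d inc assms
          by (simp add: E_def M_def)
        also have "\<dots> \<le> L * (2 / sqrt (p * (1 - p)) / real n)"
          using inverse_sqrt_vertex_pairs_le[of V p] V n assms L
          by (intro mult_left_mono) (auto simp: E_def)
        finally show "measure_pmf.prob ?P {A \<in> R. \<bar>f A - real x\<bar> \<le> M}
            \<le> L * (2 / sqrt (p * (1 - p))) / real n" by simp
      qed
      also have "\<dots> \<le> C / real n"
        unfolding add_divide_distrib[symmetric] using C(2) n by (intro divide_right_mono) auto
      finally show ?thesis unfolding eq .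
    qed
  qed
qed

end
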